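(* For every real $a>0$, $$S(a)=\int_0^\infty\frac{1}{e^{x/a}-1}\left(\frac12+\frac{1}{e^x-1}-\frac1x\right)dx.$$
   Context: Let $\psi(u)=\frac{d\ln\Gamma(u)}{du}$ be the digamma function. For real $a>0$ define $$S(a)=\sum_{n=1}^\infty\left[\ln\frac{n}{a}-\frac{a}{2n}-\psi\left(\frac{n}{a}\right)\right].$$ *)

theory Defs
  imports "HOL-Analysis.Analysis"
begin

(* The digamma function psi is the library constant Digamma; on the positive reals it is
   the logarithmic derivative of Gamma. *)
lemma Digamma_eq_deriv_ln_Gamma:
  fixes u :: real
  assumes "u > 0"
  shows "((\<lambda>t. ln (Gamma t)) has_field_derivative Digamma u) (at u)"
    and "Digamma u = deriv (\<lambda>t. ln (Gamma t)) u"
proof -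
  have "eventually (\<lambda>t. t \<in> {0<..}) (nhds u)"
    using assms by (intro eventually_nhds_in_open) auto
  hence ev: "eventually (\<lambda>t. ln_Gamma t = ln (Gamma t)) (nhds u)"
    by eventually_elim (simp add: ln_Gamma_real_pos)
  show 1: "((\<lambda>t. ln (Gamma t)) has_field_derivative Digamma u) (at u)"
    using has_field_derivative_ln_Gamma_real[OF assms] DERIV_cong_ev[OF refl ev refl] by simp
  show "Digamma u = deriv (\<lambda>t. ln (Gamma t)) u"
    using DERIV_imp_deriv[OF 1] by simp
qed

definition S_term :: "real \<Rightarrow> nat \<Rightarrow> real" where
  "S_term a n = ln (real n / a) - a / (2 * real n) - Digamma (real n / a)"

(* The sum starts at n = 1, hence the index shift. *)
definition S :: "real \<Rightarrow> real" where
  "S a = (\<Sum>k. S_term a (Suc k))"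

end

theory Submission
  imports Defs "HOL-Real_Asymp.Real_Asymp"
begin

text \<open>
  With \<open>\<phi>(x) = 1/2 + 1/(e\<^sup>x - 1) - 1/x\<close>, the integrals \<open>\<integral> \<phi>(x) (1 - e\<^sup>-\<^sup>x) e\<^sup>-\<^sup>u\<^sup>x dx\<close>
  are elementary up to a Frullani integral. Expanding \<open>1 = (1 - e\<^sup>-\<^sup>x) \<Sum>\<^sub>k e\<^sup>-\<^sup>k\<^sup>x\<close> and summing over
  \<open>u + k\<close> telescopes to Binet's formula
  \<open>\<integral> \<phi>(x) e\<^sup>-\<^sup>u\<^sup>x dx = ln u - 1/(2u) - \<psi>(u)\<close>. Since \<open>0 \<le> \<phi>(x) \<le> x/4\<close>, this is at most
  \<open>1/(4u\<^sup>2)\<close>, so Binet's formula can be summed over \<open>u = n/a\<close> by monotone convergence.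
\<close>

section \<open>Bounds for the kernel of Binet's formula\<close>

definition binet_kernel :: "real \<Rightarrow> real" where
  "binet_kernel x = 1 / 2 + 1 / (exp x - 1) - 1 / x"

lemma binet_kernel_measurable [measurable]: "binet_kernel \<in> borel_measurable borel"
  unfolding binet_kernel_def [abs_def] by measurable

text \<open>Over the common denominator \<open>2 * x * (exp x - 1)\<close> the numerator is
  \<open>(x - 2) * exp x + x + 2\<close>. It vanishes at 0, and it is nondecreasing because its
  derivative factors as \<open>exp t * (exp (- t) - (1 - t))\<close>, where the tangent inequality
  for \<open>exp\<close> at \<open>- t\<close> applies.\<close>

lemma binet_kernel_nonneg:
  assumes "x > 0"
  shows "binet_kernel x \<ge> 0"
proof -
  have "(0 - 2) * exp 0 + 0 + 2 \<le> (x - 2) * exp x + x + (2 :: real)"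
  proof (rule DERIV_nonneg_imp_nondecreasing [where f = "\<lambda>x. (x - 2) * exp x + x + 2"])
    fix t :: real
    have "((\<lambda>x. (x - 2) * exp x + x + 2) has_real_derivative (t - 1) * exp t + 1) (at t)"
      by (auto intro!: derivative_eq_intros simp: algebra_simps)
    moreover have "(t - 1) * exp t + 1 = exp t * (exp (- t) - (1 + (- t)))"
      by (simp add: algebra_simps flip: exp_add)
    moreover have "exp t * (exp (- t) - (1 + (- t))) \<ge> 0"
      using exp_ge_add_one_self [of "- t"] by (intro mult_nonneg_nonneg) auto
    ultimately show "\<exists>y. ((\<lambda>x. (x - 2) * exp x + x + 2) has_real_derivative y) (at t) \<and> 0 \<le> y"
      by (intro exI [of _ "(t - 1) * exp t + 1"] conjI) (simp_all only:)
  qed (use assms in auto)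
  moreover have "binet_kernel x = ((x - 2) * exp x + x + 2) / (2 * x * (exp x - 1))"
    using assms by (simp add: binet_kernel_def divide_simps) (simp add: algebra_simps)
  ultimately show ?thesis
    using assms by (auto intro!: divide_nonneg_nonneg)
qed

text \<open>The quadratic Taylor bound on \<open>exp x - 1\<close> has a reciprocal whose partial
  fractions contain exactly \<open>1 / x\<close>. The pole therefore cancels and
  \<open>1 / 2 - 1 / (2 + x) = x / (2 * (2 + x))\<close> remains.\<close>

lemma binet_kernel_le:
  assumes "x > 0"
  shows "binet_kernel x \<le> x / 4"
proof -
  have "x + x\<^sup>2 / 2 \<le> exp x - 1"
    using exp_lower_Taylor_quadratic [of x] assms by linarith
  then have "1 / (exp x - 1) \<le> 1 / (x + x\<^sup>2 / 2)"
    using assms by (intro divide_left_mono) (auto intro!: mult_pos_pos add_pos_pos)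
  also have "x + x\<^sup>2 / 2 = x * (2 + x) / 2"
    by (simp add: power2_eq_square algebra_simps)
  also have "1 / (x * (2 + x) / 2) = 1 / x - 1 / (2 + x)"
    using assms by (simp add: diff_frac_eq)
  finally have "binet_kernel x \<le> 1 / 2 - 1 / (2 + x)"
    by (simp add: binet_kernel_def)
  also have "\<dots> \<le> x / 4"
    using assms by (simp add: field_simps)
  finally show ?thesis .
qed

section \<open>Integrals of nonnegative functions and three elementary cases\<close>

lemma has_bochner_integral_FTC_greaterThan:
  fixes f F :: "real \<Rightarrow> real"
  assumes [measurable]: "f \<in> borel_measurable borel"
    and "\<And>x. x \<ge> a \<Longrightarrow> (F has_real_derivative f x) (at x)"
    and nonneg: "\<And>x. x \<ge> a \<Longrightarrow> f x \<ge> 0"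
    and lim: "(F \<longlongrightarrow> T) at_top"
  shows "has_bochner_integral lborel (\<lambda>x. indicator {a<..} x * f x) (T - F a)"
proof (rule has_bochner_integral_nn_integral)
  have "(\<integral>\<^sup>+ x. ennreal (indicator {a<..} x * f x) \<partial>lborel) =
        (\<integral>\<^sup>+ x. ennreal (f x) * indicator {a..} x \<partial>lborel)"
    \<comment> \<open>The open and the closed half-line differ only in the null set
      \<open>{a}\<close>.\<close>
    using AE_lborel_singleton [of a]
    by (intro nn_integral_cong_AE) (auto split: split_indicator)
  also have "\<dots> = ennreal (T - F a)"
    using assms by (intro nn_integral_FTC_atLeast)
  finally show "(\<integral>\<^sup>+ x. ennreal (indicator {a<..} x * f x) \<partial>lborel) = ennreal (T - F a)" .
  have "F a \<le> F x" if "x \<ge> a" for x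
    using that assms by (intro DERIV_nonneg_imp_nondecreasing [of a x F]) auto
  then have "eventually (\<lambda>x. F a \<le> F x) at_top"
    using eventually_ge_at_top [of a] by (rule eventually_mono [rotated])
  from tendsto_lowerbound [OF lim this] show "T - F a \<ge> 0"
    by simp
qed (use nonneg in \<open>auto split: split_indicator\<close>)

text \<open>Monotone convergence for Bochner integrals. Since the terms are nonnegative, the
  integrals of their norms are the values \<open>v k\<close> themselves, so summability of
  \<open>v\<close> is what \<open>integrable_suminf\<close> and \<open>integral_suminf\<close> ask
  for.\<close>

lemma has_bochner_integral_sums_nonneg:
  fixes f :: "nat \<Rightarrow> 'a \<Rightarrow> real"
  assumes int: "\<And>k. has_bochner_integral M (f k) (v k)"
    and nonneg: "\<And>k x. f k x \<ge> 0"
    and sums: "\<And>x. (\<lambda>k. f k x) sums F x"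
    and v: "summable v"
  shows "has_bochner_integral M F (suminf v)"
proof -
  have F: "F = (\<lambda>x. \<Sum>k. f k x)"
    using sums by (auto simp: sums_iff)
  have *: "integrable M (f k)" "AE x in M. summable (\<lambda>k. norm (f k x))"
    "(\<lambda>k. \<integral>x. norm (f k x) \<partial>M) = v" for k
    using int nonneg sums by (auto simp: has_bochner_integral_iff sums_iff)
  have "integrable M F"
    unfolding F by (rule integrable_suminf) (use * v in auto)
  moreover have "integral\<^sup>L M F = (\<Sum>k. integral\<^sup>L M (f k))"
    unfolding F by (rule integral_suminf) (use * v in auto)
  ultimately show ?thesis
    using int by (simp add: has_bochner_integral_iff)
qed

lemma has_bochner_integral_exp_neg:
  fixes u :: real
  assumes "u > 0"
  shows "has_bochner_integral lborel (\<lambda>x. indicator {0<..} x * exp (- (u * x))) (1 / u)"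
proof -
  have "((\<lambda>x. - exp (- (u * x)) / u) \<longlongrightarrow> 0) at_top"
    using assms by real_asymp
  then have "has_bochner_integral lborel (\<lambda>x. indicator {0<..} x * exp (- (u * x)))
      (0 - (- exp (- (u * 0)) / u))"
    using assms
    by (intro has_bochner_integral_FTC_greaterThan [where F = "\<lambda>x. - exp (- (u * x)) / u"])
      (auto intro!: derivative_eq_intros)
  then show ?thesis by simp
qed

lemma has_bochner_integral_times_exp_neg:
  fixes u :: real
  assumes "u > 0"
  shows "has_bochner_integral lborel (\<lambda>x. indicator {0<..} x * (x * exp (- (u * x)))) (1 / u\<^sup>2)"
proof -
  have "((\<lambda>x. - (x / u + 1 / u\<^sup>2) * exp (- (u * x))) \<longlongrightarrow> 0) at_top"
    using assms by real_asymp
  then have "has_bochner_integral lborel (\<lambda>x. indicator {0<..} x * (x * exp (- (u * x))))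
      (0 - (- (0 / u + 1 / u\<^sup>2) * exp (- (u * 0))))"
    using assms
    by (intro has_bochner_integral_FTC_greaterThan
          [where F = "\<lambda>x. - (x / u + 1 / u\<^sup>2) * exp (- (u * x))"])
      (auto intro!: derivative_eq_intros simp: field_simps power2_eq_square)
  then show ?thesis by simp
qed

text \<open>Frullani's integral, by Fubini from \<open>(1 - e\<^sup>-\<^sup>x) e\<^sup>-\<^sup>u\<^sup>x / x = \<integral> e\<^sup>-\<^sup>t\<^sup>x dt\<close> over \<open>u \<le> t \<le> u + 1\<close>.\<close>

lemma has_bochner_integral_Frullani_exp:
  fixes u :: real
  assumes u: "u > 0"
  shows "has_bochner_integral lborel
    (\<lambda>x. indicator {0<..} x * ((1 - exp (- x)) / x * exp (- (u * x)))) (ln ((u + 1) / u))"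
proof (rule has_bochner_integral_nn_integral)
  let ?f = "\<lambda>(x::real) (t::real). ennreal (indicator {0<..} x * exp (- (t * x))) * indicator {u..u+1} t"
  have inner: "(\<integral>\<^sup>+ t. ?f x t \<partial>lborel) =
      ennreal (indicator {0<..} x * ((1 - exp (- x)) / x * exp (- (u * x))))" for x
  proof (cases "x > 0")
    case True
    have "(\<integral>\<^sup>+ t. ennreal (exp (- (t * x))) * indicator {u..u+1} t \<partial>lborel) =
        ennreal (- exp (- ((u + 1) * x)) / x - (- exp (- (u * x)) / x))"
      using True by (intro nn_integral_FTC_Icc) (auto intro!: derivative_eq_intros)
    also have "- exp (- ((u + 1) * x)) / x - (- exp (- (u * x)) / x) =
        (1 - exp (- x)) / x * exp (- (u * x))"
      using True by (simp add: field_simps flip: exp_add)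
    finally show ?thesis using True by simp
  qed simp
  have outer: "(\<integral>\<^sup>+ x. ?f x t \<partial>lborel) = ennreal (1 / t) * indicator {u..u+1} t" for t
  proof (cases "t \<in> {u..u+1}")
    case True
    then have "has_bochner_integral lborel (\<lambda>x. indicator {0<..} x * exp (- (t * x))) (1 / t)"
      using u by (intro has_bochner_integral_exp_neg) auto
    then have "(\<integral>\<^sup>+ x. ennreal (indicator {0<..} x * exp (- (t * x))) \<partial>lborel) = ennreal (1 / t)"
      using nn_integral_eq_integral [of lborel "\<lambda>x. indicator {0<..} x * exp (- (t * x))"]
      by (simp add: has_bochner_integral_iff)
    then show ?thesis using True by simp
  qed simp
  have "(\<integral>\<^sup>+ x. ennreal (indicator {0<..} x * ((1 - exp (- x)) / x * exp (- (u * x)))) \<partial>lborel) =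
      (\<integral>\<^sup>+ x. (\<integral>\<^sup>+ t. ?f x t \<partial>lborel) \<partial>lborel)"
    by (simp only: inner)
  \<comment> \<open>The integrand takes values in \<open>ennreal\<close>, so joint measurability is
    enough to swap the integrals.\<close>
  also have "\<dots> = (\<integral>\<^sup>+ t. (\<integral>\<^sup>+ x. ?f x t \<partial>lborel) \<partial>lborel)"
    by (rule lborel_pair.Fubini' [symmetric]) measurable
  also have "\<dots> = (\<integral>\<^sup>+ t. ennreal (1 / t) * indicator {u..u+1} t \<partial>lborel)"
    by (simp only: outer)
  also have "\<dots> = ennreal (ln (u + 1) - ln u)"
    using u by (intro nn_integral_FTC_Icc)
      (auto intro!: derivative_eq_intros)
  also have "ln (u + 1) - ln u = ln ((u + 1) / u)"
    using u by (simp add: ln_div)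
  finally show "(\<integral>\<^sup>+ x. ennreal (indicator {0<..} x * ((1 - exp (- x)) / x * exp (- (u * x)))) \<partial>lborel) =
      ennreal (ln ((u + 1) / u))" .
qed (use u in \<open>auto split: split_indicator\<close>)

section \<open>Binet's formula by telescoping\<close>

text \<open>For \<open>u > 0\<close> this is the difference between the values of
  \<open>ln u - 1 / (2 * u) - Digamma u\<close> at \<open>u\<close> and at \<open>u + 1\<close>. It
  is also the error of the trapezoidal rule for \<open>1 / t\<close> on
  \<open>[u, u + 1]\<close>.\<close>

definition binet_step :: "real \<Rightarrow> real" where
  "binet_step u = 1 / (2 * u) + 1 / (2 * (u + 1)) - ln ((u + 1) / u)"

text \<open>The factor \<open>1 - exp (- x)\<close> clears the denominator \<open>exp x - 1\<close>:
  its product with the kernel is \<open>(1 + exp (- x)) / 2 - (1 - exp (- x)) / x\<close>. This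
  leaves two exponential integrals and a Frullani integral.\<close>

lemma has_bochner_integral_binet_step:
  assumes u: "u > 0"
  shows "has_bochner_integral lborel
    (\<lambda>x. indicator {0<..} x * (binet_kernel x * (1 - exp (- x)) * exp (- (u * x)))) (binet_step u)"
proof -
  let ?E = "\<lambda>u x :: real. indicator {0<..} x * exp (- (u * x)) :: real"
  let ?L = "\<lambda>x :: real. indicator {0<..} x * ((1 - exp (- x)) / x * exp (- (u * x))) :: real"
  have "has_bochner_integral lborel (\<lambda>x. ?E u x / 2 + ?E (u + 1) x / 2 - ?L x)
      (1 / u / 2 + 1 / (u + 1) / 2 - ln ((u + 1) / u))"
    using u by (intro has_bochner_integral_diff has_bochner_integral_add has_bochner_integral_divide
        has_bochner_integral_exp_neg has_bochner_integral_Frullani_exp) auto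
  also have "(\<lambda>x. ?E u x / 2 + ?E (u + 1) x / 2 - ?L x) =
      (\<lambda>x. indicator {0<..} x * (binet_kernel x * (1 - exp (- x)) * exp (- (u * x))))"
  proof
    fix x :: real
    have "exp (- (u * x)) / 2 + exp (- ((u + 1) * x)) / 2 - (1 - exp (- x)) / x * exp (- (u * x)) =
        binet_kernel x * (1 - exp (- x)) * exp (- (u * x))" if "x > 0"
    proof -
      have "exp (- ((u + 1) * x)) = exp (- x) * exp (- (u * x))"
        by (simp add: algebra_simps flip: exp_add)
      moreover have "binet_kernel x * (1 - exp (- x)) = 1 / 2 + exp (- x) / 2 - (1 - exp (- x)) / x"
        using that by (simp add: binet_kernel_def exp_minus divide_simps) (simp add: algebra_simps)
      ultimately show ?thesis
        by (simp only:) (simp add: algebra_simps)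
    qed
    then show "?E u x / 2 + ?E (u + 1) x / 2 - ?L x =
        indicator {0<..} x * (binet_kernel x * (1 - exp (- x)) * exp (- (u * x)))"
      by (auto split: split_indicator)
  qed
  also have "1 / u / 2 + 1 / (u + 1) / 2 - ln ((u + 1) / u) = binet_step u"
    by (simp add: binet_step_def mult.commute)
  finally show ?thesis .
qed

lemma binet_step_sums:
  assumes u: "u > 0"
  shows "(\<lambda>k. binet_step (u + real k)) sums (ln u - 1 / (2 * u) - Digamma u)"
proof -
  \<comment> \<open>The logarithms telescope and neighbouring halves combine to
    \<open>1 / (u + k)\<close>. The term \<open>ln (real n)\<close> is subtracted and added back, so
    that the first bracket is the sequence of \<open>Digamma_LIMSEQ\<close> and the last one tends
    to 0; at \<open>n = 0\<close> its two occurrences cancel.\<close>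
  have partial: "(\<Sum>k<n. binet_step (u + real k)) =
      ln u - 1 / (2 * u) - (ln (real n) - (\<Sum>k<n. inverse (u + real k)))
      + (1 / (2 * (u + real n)) - (ln (u + real n) - ln (real n)))" for n
  proof (induction n)
    case (Suc n)
    have "binet_step (u + real n) = inverse (u + real n) - 1 / (2 * (u + real n))
        + 1 / (2 * (u + real (Suc n))) - (ln (u + real (Suc n)) - ln (u + real n))"
      using u by (simp add: binet_step_def ln_div inverse_eq_divide add_ac)
        (simp add: field_simps)
    then show ?case
      by (simp add: Suc)
  qed simp
  have "u \<noteq> - real n" for n
    using u by (smt (verit) of_nat_0_le_iff)
  then have "(\<lambda>n. ln (real n) - (\<Sum>k<n. inverse (u + real k))) \<longlonglongrightarrow> Digamma u"
    using Digamma_LIMSEQ [of u] u by simp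
  moreover have "(\<lambda>n. 1 / (2 * (u + real n)) - (ln (u + real n) - ln (real n))) \<longlonglongrightarrow> 0"
    by real_asymp
  ultimately have "(\<lambda>n. \<Sum>k<n. binet_step (u + real k))
      \<longlonglongrightarrow> ln u - 1 / (2 * u) - Digamma u + 0"
    unfolding partial by (intro tendsto_add tendsto_diff tendsto_const)
  then show ?thesis
    by (simp add: sums_def)
qed

lemma has_bochner_integral_binet:
  assumes u: "u > 0"
  shows "has_bochner_integral lborel (\<lambda>x. indicator {0<..} x * (binet_kernel x * exp (- (u * x))))
    (ln u - 1 / (2 * u) - Digamma u)"
proof -
  let ?f = "\<lambda>k x :: real. indicator {0<..} x *
    (binet_kernel x * (1 - exp (- x)) * exp (- ((u + k) * x)))"
  \<comment> \<open>The geometric series in \<open>exp (- x)\<close> cancels the factor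
    \<open>1 - exp (- x)\<close>. For \<open>x \<le> 0\<close> the indicator makes all terms 0, so
    the identity holds at every point.\<close>
  have "(\<lambda>k. ?f (real k) x) sums (indicator {0<..} x * (binet_kernel x * exp (- (u * x))))" for x
  proof (cases "x > 0")
    case True
    then have "(\<lambda>k. binet_kernel x * (1 - exp (- x)) * exp (- (u * x)) * exp (- x) ^ k) sums
        (binet_kernel x * (1 - exp (- x)) * exp (- (u * x)) * (1 / (1 - exp (- x))))"
      by (intro sums_mult geometric_sums) simp
    moreover have "exp (- (u * x)) * exp (- x) ^ k = exp (- ((u + real k) * x))" for k
      by (simp add: algebra_simps flip: exp_add exp_of_nat_mult)
    ultimately show ?thesis
      using True by (simp add: mult.assoc)
  qed simp
  moreover have "?f (real k) x \<ge> 0" for k x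
    using binet_kernel_nonneg [of x] by (auto split: split_indicator)
  ultimately have "has_bochner_integral lborel
      (\<lambda>x. indicator {0<..} x * (binet_kernel x * exp (- (u * x))))
      (\<Sum>k. binet_step (u + real k))"
    using u binet_step_sums [OF u]
    by (intro has_bochner_integral_sums_nonneg [where f = "\<lambda>k. ?f (real k)"]
        has_bochner_integral_binet_step) (auto simp: sums_iff)
  then show ?thesis
    using binet_step_sums [OF u] by (simp add: sums_iff)
qed

lemma binet_bounds:
  fixes u :: real
  assumes u: "u > 0"
  shows "0 \<le> ln u - 1 / (2 * u) - Digamma u" "ln u - 1 / (2 * u) - Digamma u \<le> 1 / (4 * u\<^sup>2)"
proof -
  have q: "has_bochner_integral lborel (\<lambda>x. indicator {0<..} x * (x * exp (- (u * x))) / 4)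
      (1 / u\<^sup>2 / 4)"
    using u by (intro has_bochner_integral_divide has_bochner_integral_times_exp_neg) auto
  have "integral\<^sup>L lborel (\<lambda>x. indicator {0<..} x * (binet_kernel x * exp (- (u * x))))
      \<le> integral\<^sup>L lborel (\<lambda>x. indicator {0<..} x * (x * exp (- (u * x))) / 4)"
    using q has_bochner_integral_binet [OF u] binet_kernel_le
    by (intro integral_mono) (auto simp: has_bochner_integral_iff split: split_indicator)
  then show "ln u - 1 / (2 * u) - Digamma u \<le> 1 / (4 * u\<^sup>2)"
    using q has_bochner_integral_binet [OF u] by (simp add: has_bochner_integral_iff mult.commute)
  have "0 \<le> integral\<^sup>L lborel (\<lambda>x. indicator {0<..} x * (binet_kernel x * exp (- (u * x))))"
    using binet_kernel_nonneg by (intro integral_nonneg_AE) (auto split: split_indicator)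
  then show "0 \<le> ln u - 1 / (2 * u) - Digamma u"
    using has_bochner_integral_binet [OF u] by (simp add: has_bochner_integral_iff)
qed

section \<open>Summation of Binet's formula over \<open>n / a\<close>\<close>

lemma S_term_eq_binet:
  "S_term a n = ln (real n / a) - 1 / (2 * (real n / a)) - Digamma (real n / a)"
  by (simp add: S_term_def)

lemma summable_S_term:
  assumes a: "a > 0"
  shows "summable (\<lambda>k. S_term a (Suc k))"
proof (rule summable_comparison_test')
  have "summable (\<lambda>n. inverse (real n ^ 2))"
    by (rule inverse_power_summable) simp
  \<comment> \<open>The majorant is the bound \<open>1 / (4 * u\<^sup>2)\<close> at
    \<open>u = real (Suc k) / a\<close>.\<close>
  then show "summable (\<lambda>k. a\<^sup>2 / 4 * inverse (real (Suc k) ^ 2))"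
    unfolding summable_Suc_iff [of "\<lambda>n. a\<^sup>2 / 4 * inverse (real n ^ 2)"] by (rule summable_mult)
  show "norm (S_term a (Suc k)) \<le> a\<^sup>2 / 4 * inverse (real (Suc k) ^ 2)" if "k \<ge> 0" for k
    using binet_bounds [of "real (Suc k) / a"] a
    unfolding S_term_eq_binet by (simp add: power_divide divide_simps del: of_nat_Suc)
qed

text \<open>Convergence of the series and of the integral is asserted along with the identity,
  because \<open>suminf\<close> and the Lebesgue integral are total functions and an equation
  between them alone would not express it.\<close>

theorem mainTheorem4:
  fixes a :: real
  assumes "a > 0"
  shows "summable (\<lambda>k. S_term a (Suc k)) \<and>
    set_integrable lborel {0<..}
      (\<lambda>x. 1 / (exp (x / a) - 1) * (1 / 2 + 1 / (exp x - 1) - 1 / x)) \<and>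
    S a = (LBINT x:{0<..}. 1 / (exp (x / a) - 1) * (1 / 2 + 1 / (exp x - 1) - 1 / x))"
proof -
  let ?f = "\<lambda>k x. indicator {0<..} x * (binet_kernel x * exp (- (real (Suc k) / a * x)))"
  let ?F = "\<lambda>x. indicator {0<..} x * (1 / (exp (x / a) - 1) * binet_kernel x)"
  have sums: "(\<lambda>k. ?f k x) sums ?F x" for x
  proof (cases "x > 0")
    case True
    \<comment> \<open>The sum starts at \<open>n = 1\<close>, so the geometric series in
      \<open>q\<close> carries an extra factor \<open>q\<close>, and \<open>q / (1 - q)\<close> is
      the weight \<open>1 / (exp (x / a) - 1)\<close>.\<close>
    define q where "q = exp (- (x / a))"
    have q: "0 < q" "q < 1" using True assms by (auto simp: q_def)
    then have "(\<lambda>k. binet_kernel x * q * q ^ k) sums (binet_kernel x * q * (1 / (1 - q)))"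
      by (intro sums_mult geometric_sums) auto
    moreover have "q * q ^ k = exp (- (real (Suc k) / a * x))" for k
      unfolding q_def by (simp add: algebra_simps add_divide_distrib flip: exp_add exp_of_nat_mult)
    then have "binet_kernel x * q * q ^ k = ?f k x" for k
      using True by (simp add: mult.assoc del: of_nat_Suc)
    moreover have "q * (1 / (1 - q)) = 1 / (exp (x / a) - 1)"
      using True assms by (simp add: q_def exp_minus field_simps)
    then have "binet_kernel x * q * (1 / (1 - q)) = ?F x"
      using True by (simp only: mult.assoc) (simp add: mult.commute)
    ultimately show ?thesis
      by (simp only:)
  qed simp
  have "has_bochner_integral lborel ?F (\<Sum>k. S_term a (Suc k))"
  proof (rule has_bochner_integral_sums_nonneg [where f = ?f])
    show "has_bochner_integral lborel (?f k) (S_term a (Suc k))" for k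
      unfolding S_term_eq_binet using assms by (intro has_bochner_integral_binet) simp
    show "?f k x \<ge> 0" for k x
      using binet_kernel_nonneg [of x] by (auto split: split_indicator)
  qed (use sums summable_S_term assms in auto)
  then show ?thesis
    using summable_S_term [OF assms]
    by (simp add: has_bochner_integral_iff S_def set_integrable_def set_lebesgue_integral_def
        binet_kernel_def)
qed

end
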